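(* Let $\hat T$ be the hyperbolic-tangent random variable, i.e. the random variable with characteristic function $\phi_{\hat T}(t)=\tanh(t)/t$ ($\phi_{\hat T}(0)=1$). (i) For every $t\in\mathbb{R}$, $$\int_{\mathbb{R}\setminus\{0\}}(\cos(tx)-1)\,\frac{\pi}{8}\,\frac{1}{\cosh^2(\pi x/4)}\,dx= \frac{2t}{\sinh(2t)}-1,$$ where the right-hand side at $t=0$ is read as its limit $0$. (ii) The function $\psi_{\hat T}(t):=\exp\big(t(\log\phi_{\hat T}(t))'\big)=\exp\big[\frac{2t}{\sinh(2t)}-1\big]$ ($t\neq0$, $\psi_{\hat T}(0)=1$) is the characteristic function of a compound Poisson distribution, and therefore $\hat T\notin L_1$, where $L_1$ is the Urbanik class.
   Context: A real random variable $X$ is selfdecomposable ($X\in L_0$) if for every $t>0$ there is an infinitely divisible random variable $X_t$, independent of $X$, with $X\stackrel{d}{=}e^{-t}X+X_t$. For $k\ge 1$ the Urbanik class $L_k$ is defined inductively: $X\in L_k$ iff for every $t>0$ the relation $X\stackrel{d}{=}e^{-t}X+X_t$ holds with some $X_t\in L_{k-1}$ independent of $X$. $X\in L_0$ is equivalent to the existence of a (unique in distribution) Lévy process $(Y_X(t))_{t\ge 0}$ with $\mathbb{E}[\log(1+|Y_X(1)|)]<\infty$ and $X\stackrel{d}{=}\int_0^\infty e^{-t}\,dY_X(t)$; the characteristic function of $Y_X(1)$ is $\psi_X(t)=\exp\big(t(\log\phi_X(t))'\big)$ for $t\ne0$, $\psi_X(0)=1$, where $\phi_X$ is the characteristic function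 of $X$. *)

theory Defs
  imports "HOL-Probability.Probability"
begin

text \<open>All classes of random variables below depend only on the law, so they are defined as
  classes of laws, that is, of Borel probability measures on the real line.\<close>

definition infinitely_divisible :: "real measure \<Rightarrow> bool" where
  "infinitely_divisible \<mu> \<longleftrightarrow> real_distribution \<mu> \<and>
     (\<forall>n::nat. n \<ge> 1 \<longrightarrow> (\<exists>\<nu>. real_distribution \<nu> \<and>
        \<mu> = distr (\<Pi>\<^sub>M i\<in>{..<n}. \<nu>) borel (\<lambda>y. \<Sum>i<n. y i)))"

text \<open>By \<open>prob_space.sum_indep_random_variable\<close>, the convolution below is the law of
  \<open>exp (- t) * X + Z\<close> for independent \<open>X\<close>, \<open>Z\<close> with laws \<open>\<mu>\<close>, \<open>\<rho>\<close>.\<close>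

definition decomposes :: "real \<Rightarrow> real measure \<Rightarrow> real measure \<Rightarrow> bool" where
  "decomposes t \<mu> \<rho> \<longleftrightarrow> \<mu> = (distr \<mu> borel (\<lambda>x. exp (- t) * x) \<star> \<rho>)"

primrec urbanik_class :: "nat \<Rightarrow> real measure set" where
  "urbanik_class 0 =
     {\<mu>. real_distribution \<mu> \<and> (\<forall>t>0. \<exists>\<rho>. infinitely_divisible \<rho> \<and> decomposes t \<mu> \<rho>)}"
| "urbanik_class (Suc k) =
     {\<mu>. real_distribution \<mu> \<and> (\<forall>t>0. \<exists>\<rho>\<in>urbanik_class k. decomposes t \<mu> \<rho>)}"

text \<open>The law of \<open>Y 0 + \<dots> + Y (N - 1)\<close>, where \<open>N\<close> is Poisson with parameter \<open>r\<close> and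
  independent of the i.i.d. sequence \<open>Y\<close> with law \<open>\<nu>\<close>.\<close>

definition compound_poisson_law :: "real \<Rightarrow> real measure \<Rightarrow> real measure" where
  "compound_poisson_law r \<nu> =
     distr (measure_pmf (poisson_pmf r) \<Otimes>\<^sub>M (\<Pi>\<^sub>M i\<in>(UNIV :: nat set). \<nu>)) borel
       (\<lambda>(n, y). \<Sum>i<n. y i)"

text \<open>The usual convention that the jump law has no atom at \<open>0\<close> is adopted; in particular
  the point mass at \<open>0\<close> does not count as compound Poisson.\<close>

definition compound_poisson :: "real measure \<Rightarrow> bool" where
  "compound_poisson \<mu> \<longleftrightarrow>
     (\<exists>r>0. \<exists>\<nu>. real_distribution \<nu> \<and> measure \<nu> {0} = 0 \<and> \<mu> = compound_poisson_law r \<nu>)"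

lemma real_distribution_compound_poisson_law:
  assumes "real_distribution \<nu>"
  shows "real_distribution (compound_poisson_law r \<nu>)"
proof -
  interpret \<nu>: real_distribution \<nu> by fact
  interpret P: prob_space "measure_pmf (poisson_pmf r) \<Otimes>\<^sub>M (\<Pi>\<^sub>M i\<in>(UNIV :: nat set). \<nu>)"
    by (intro prob_space_pair prob_space_PiM prob_space_measure_pmf \<nu>.prob_space_axioms)
  have "(\<lambda>(n, y). \<Sum>i<n. y i) \<in>
      borel_measurable (count_space UNIV \<Otimes>\<^sub>M (\<Pi>\<^sub>M i\<in>(UNIV :: nat set). \<nu>))"
    by (rule measurable_pair_measure_countable1) auto
  then have "(\<lambda>(n, y). \<Sum>i<n. y i) \<in>
      borel_measurable (measure_pmf (poisson_pmf r) \<Otimes>\<^sub>M (\<Pi>\<^sub>M i\<in>(UNIV :: nat set). \<nu>))"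
    by (simp cong: measurable_cong_sets sets_pair_measure_cong)
  then show ?thesis
    unfolding compound_poisson_law_def by (rule P.real_distribution_distr)
qed

text \<open>The logarithm of a characteristic function without zeros is the distinguished one: the
  unique continuous logarithm vanishing at \<open>0\<close>.\<close>

definition distinguished_log :: "(real \<Rightarrow> complex) \<Rightarrow> real \<Rightarrow> complex" where
  "distinguished_log \<phi> =
     (THE g. continuous_on UNIV g \<and> g 0 = 0 \<and> (\<forall>t. exp (g t) = \<phi> t))"

text \<open>The candidate characteristic function of the background driving variable at time \<open>1\<close>.\<close>

definition bdlp_char :: "(real \<Rightarrow> complex) \<Rightarrow> real \<Rightarrow> complex" where
  "bdlp_char \<phi> t =
     (if t = 0 then 1
      else exp (of_real t * vector_derivative (distinguished_log \<phi>) (at t)))"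

end

theory Submission
  imports Defs "HOL-Real_Asymp.Real_Asymp"
begin

text \<open>
  Two observations carry the proof.

  The function \<open>2 * t / sinh (2 * t)\<close> is the characteristic function of a rescaled logistic
  law. The reason is that the difference of two independent variables with density
  \<open>exp (u - exp u)\<close> is logistic (\<open>gumbel_symmetrization\<close>), while Euler's integral, read in the
  variable \<open>u = ln x\<close>, gives this density the characteristic function
  \<open>Gamma (1 + \<i> * s)\<close> (\<open>gumbel_fourier\<close>). Hence the logistic law has characteristic function
  \<open>Gamma (1 + \<i> * s) * Gamma (1 - \<i> * s)\<close>, which the reflection formula turns into
  \<open>pi * s / sinh (pi * s)\<close> (\<open>char_logistic\<close>). Taking real parts at \<open>s = 2 * t / pi\<close> yields the
  cosine integral; exponentiating yields the compound Poisson law with rate \<open>1\<close> and logistic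
  jumps, because a compound Poisson law has characteristic function \<open>exp (r * (\<phi> - 1))\<close>
  (\<open>char_compound_poisson_law\<close>). That the driving function of \<open>tanh t / t\<close> is this exponential
  is a differentiation, once the distinguished logarithm of a positive function is known to be
  its real logarithm (\<open>distinguished_log_pos\<close>).

  The exclusion from the class \<open>L\<^sub>1\<close> comes from the decay of \<open>tanh t / t\<close> at infinity.
  Decomposing twice with \<open>exp (- t) = 1 / 2\<close>, membership would make
  \<open>\<phi> s * \<phi> (s / 4) / (\<phi> (s / 2))\<^sup>2\<close> the characteristic function of a probability law.
  For \<open>\<phi> s = tanh s / s\<close> the powers of \<open>s\<close> cancel, so that this quotient tends to \<open>1\<close> at
  infinity, which only the point mass at \<open>0\<close> allows (\<open>Re_char_eq_1_if_tendsto_1\<close>). The quotient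
  would then be constantly \<open>1\<close>, and the duplication formula for \<open>tanh\<close> refutes this.
\<close>

section \<open>Scaling and convolution\<close>

lemma char_distr_scale:
  fixes \<mu> :: "real measure"
  assumes "sets \<mu> = sets borel"
  shows "char (distr \<mu> borel (\<lambda>x. c * x)) t = char \<mu> (c * t)"
proof -
  note [measurable_cong] = assms
  show ?thesis
    unfolding char_def by (subst integral_distr) (auto simp: mult_ac)
qed

lemma char_convolution:
  assumes "real_distribution \<mu>" "real_distribution \<nu>"
  shows "char (\<mu> \<star> \<nu>) t = char \<mu> t * char \<nu> t"
proof -
  interpret \<mu>: real_distribution \<mu> by fact
  interpret \<nu>: real_distribution \<nu> by fact
  interpret P: pair_prob_space \<mu> \<nu> ..
  have [measurable_cong]: "sets \<mu> = sets borel" "sets \<nu> = sets borel"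
    by (simp_all add: \<mu>.events_eq_borel \<nu>.events_eq_borel)
  have int: "complex_integrable (\<mu> \<Otimes>\<^sub>M \<nu>) (\<lambda>p. iexp (t * (fst p + snd p)))"
    by (intro P.integrable_iexp) auto
  have "char (\<mu> \<star> \<nu>) t = (CLINT p|\<mu> \<Otimes>\<^sub>M \<nu>. iexp (t * (fst p + snd p)))"
    unfolding char_def convolution_def by (subst integral_distr) (auto simp: case_prod_unfold)
  also have "\<dots> = (CLINT x|\<mu>. (CLINT y|\<nu>. iexp (t * x) * iexp (t * y)))"
    using P.integral_fst'[OF int] by (simp add: ring_distribs exp_add)
  also have "\<dots> = char \<mu> t * char \<nu> t"
    by (simp add: char_def)
  finally show ?thesis .
qed

lemma real_distribution_convolution:
  assumes "real_distribution \<mu>" "real_distribution \<nu>"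
  shows "real_distribution (\<mu> \<star> \<nu>)"
proof -
  interpret \<mu>: real_distribution \<mu> by fact
  interpret \<nu>: real_distribution \<nu> by fact
  interpret P: pair_prob_space \<mu> \<nu> ..
  have [measurable_cong]: "sets \<mu> = sets borel" "sets \<nu> = sets borel"
    by (simp_all add: \<mu>.events_eq_borel \<nu>.events_eq_borel)
  show ?thesis
    unfolding convolution_def by (rule P.real_distribution_distr) measurable
qed

section \<open>The characteristic function of the logistic law\<close>

text \<open>The substitution \<open>x = exp u\<close> in Euler's integral of \<open>x powr (\<i> * s) * exp (- x)\<close> over the
  positive half-line.\<close>

lemma gumbel_fourier:
  fixes s :: real
  shows "integrable lborel (\<lambda>u. exp (u - exp u) *\<^sub>R iexp (s * u))"
    and "(CLINT u|lborel. exp (u - exp u) *\<^sub>R iexp (s * u)) = Gamma (1 + \<i> * s)"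
proof -
  let ?f = "\<lambda>t::real. complex_of_real t powr (1 + \<i> * s - 1) / of_real (exp t)"
  let ?h = "\<lambda>u::real. exp (u - exp u) *\<^sub>R iexp (s * u)"
  have "?f absolutely_integrable_on {0<..}" "integral {0<..} ?f = Gamma (1 + \<i> * s)"
    using absolutely_integrable_Gamma_integral'[of "1 + \<i> * s"]
      Gamma_integral_complex'[of "1 + \<i> * s"] by (auto simp: integral_unique)
  moreover have img: "exp ` UNIV = {0::real<..}"
    by (auto simp: image_iff) (metis exp_ln)
  ultimately have "(\<lambda>u::real. \<bar>exp u\<bar> *\<^sub>R ?f (exp u)) absolutely_integrable_on UNIV \<and>
      integral UNIV (\<lambda>u::real. \<bar>exp u\<bar> *\<^sub>R ?f (exp u)) = Gamma (1 + \<i> * s)"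
    by (subst has_absolute_integral_change_of_variables_real)
       (auto intro!: derivative_eq_intros inj_onI)
  moreover have "(\<lambda>u::real. \<bar>exp u\<bar> *\<^sub>R ?f (exp u)) = ?h"
    by (auto simp: fun_eq_iff powr_def Ln_of_real exp_diff scaleR_conv_of_real field_simps
        simp flip: exp_of_real exp_add)
  ultimately have *: "?h absolutely_integrable_on UNIV" "integral UNIV ?h = Gamma (1 + \<i> * s)"
    by auto
  have "?h \<in> borel_measurable lborel"
    by measurable
  with *(1) show int: "integrable lborel ?h"
    by (simp add: set_integrable_def integrable_completion)
  show "integral\<^sup>L lborel ?h = Gamma (1 + \<i> * s)"
    using integral_lborel[OF int] *(2) by simp
qed

text \<open>The law of \<open>ln E\<close> for a standard exponential variable \<open>E\<close>, that is, the reflection of what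
  is usually called the standard Gumbel law.\<close>

definition gumbel :: "real measure" where
  "gumbel = density lborel (\<lambda>u. ennreal (exp (u - exp u)))"

definition logistic :: "real measure" where
  "logistic = density lborel (\<lambda>x. ennreal (exp x / (1 + exp x)\<^sup>2))"

lemma real_distribution_densityI:
  assumes "f \<in> borel_measurable borel" "\<And>x. 0 \<le> f x" "integrable lborel f" "integral\<^sup>L lborel f = 1"
  shows "real_distribution (density lborel (\<lambda>x. ennreal (f x)))"
proof -
  have "prob_space (density lborel (\<lambda>x. ennreal (f x)))"
    by (rule prob_spaceI) (use assms in \<open>simp add: emeasure_density nn_integral_eq_integral\<close>)
  then show ?thesis
    by (simp add: real_distribution_def real_distribution_axioms_def)
qed

lemma real_distribution_gumbel: "real_distribution gumbel"
  unfolding gumbel_def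
proof (rule real_distribution_densityI)
  have *: "(\<lambda>u. complex_of_real (exp (u - exp u))) = (\<lambda>u. exp (u - exp u) *\<^sub>R iexp (0 * u))"
    by (simp add: scaleR_conv_of_real)
  have "integrable lborel (\<lambda>u. complex_of_real (exp (u - exp u)))"
    unfolding * by (rule gumbel_fourier)
  then show "integrable lborel (\<lambda>u::real. exp (u - exp u))"
    by (simp only: complex_of_real_integrable_eq)
  have "(CLINT u|lborel. complex_of_real (exp (u - exp u))) = 1"
    unfolding * by (subst gumbel_fourier) simp
  then show "(LINT u|lborel. exp (u - exp u)) = (1::real)"
    by (simp only: integral_complex_of_real of_real_eq_1_iff)
qed auto

lemma char_gumbel: "char gumbel s = Gamma (1 + \<i> * s)"
  unfolding char_def gumbel_def
  by (subst integral_density) (use gumbel_fourier(2)[of s] in simp_all)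

text \<open>The density of a difference of two independent copies is the integral of
  \<open>g (x - y) * g (- y)\<close> over \<open>y\<close>. With \<open>z = exp (- y)\<close> the integrand is an exponential times a
  polynomial in \<open>z\<close>, and so has an elementary antiderivative. Probabilistically, this is the fact
  that the logarithm of the ratio of two independent exponential variables is logistic.\<close>

lemma gumbel_symmetrization:
  "gumbel \<star> distr gumbel borel (\<lambda>x. - 1 * x) = logistic"
proof -
  let ?g = "\<lambda>u::real. exp (u - exp u)"
  have neg: "distr gumbel borel (\<lambda>x. - 1 * x) = density lborel (\<lambda>u. ennreal (?g (- u)))"
  proof -
    have "density lborel (\<lambda>u. ennreal (?g (- u)))
        = density (distr lborel borel uminus) (\<lambda>u. ennreal (?g (- u)))"
      by (simp add: lborel_distr_uminus)
    also have "\<dots> = distr gumbel borel uminus"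
      unfolding gumbel_def by (subst density_distr) (auto simp: comp_def)
    finally show ?thesis by simp
  qed
  have int: "(\<integral>\<^sup>+y. ennreal (?g (x - y)) * ennreal (?g (- y)) \<partial>lborel)
      = ennreal (exp x / (1 + exp x)\<^sup>2)" for x
  proof -
    \<comment> \<open>\<open>F\<close> is the antiderivative of \<open>f\<close> obtained by parts in the variable \<open>z = exp (- y)\<close>,
      where \<open>c\<close> collects the two exponents \<open>z\<close> and \<open>z * exp x\<close>.\<close>
    define c where "c = 1 + exp x"
    have c: "c > 0" unfolding c_def by (simp add: add_pos_pos)
    define f where "f y = exp x * (exp (- y))\<^sup>2 * exp (- (c * exp (- y)))" for y
    define F where "F y = exp x * (exp (- y) / c + 1 / c\<^sup>2) * exp (- (c * exp (- y)))" for y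
    have gf: "?g (x - y) * ?g (- y) = f y" for y
      unfolding f_def c_def
      by (simp add: power2_eq_square algebra_simps flip: exp_add)
    have dF: "(F has_real_derivative f y) (at y)" for y
      unfolding F_def f_def using c
      by (auto intro!: derivative_eq_intros simp: field_simps power2_eq_square)
    have lim: "(F \<longlongrightarrow> 0) at_bot" "(F \<longlongrightarrow> exp x / c\<^sup>2) at_top"
      unfolding F_def using c by real_asymp+
    have cont: "isCont f y" for y
      unfolding f_def by (intro continuous_intros)
    have nonneg: "0 \<le> f y" for y
      unfolding f_def by simp
    have fi: "set_integrable lborel (einterval (-\<infinity>) \<infinity>) f" "(LBINT y=-\<infinity>..\<infinity>. f y) = exp x / c\<^sup>2 - 0"
      using interval_integral_FTC_nonneg[where F = F and f = f and a = "-\<infinity>" and b = \<infinity>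
          and A = 0 and B = "exp x / c\<^sup>2"] dF lim cont nonneg
      by (simp_all add: ereal_tendsto_simps)
    then have "integrable lborel f" "integral\<^sup>L lborel f = exp x / c\<^sup>2"
      by (simp_all add: set_integrable_def interval_lebesgue_integral_def set_lebesgue_integral_def)
    then have "(\<integral>\<^sup>+y. ennreal (f y) \<partial>lborel) = ennreal (exp x / c\<^sup>2)"
      by (subst nn_integral_eq_integral) (auto simp: f_def)
    then show ?thesis
      by (simp add: gf c_def flip: ennreal_mult)
  qed
  interpret G: real_distribution gumbel by (rule real_distribution_gumbel)
  interpret G': prob_space "distr gumbel borel (\<lambda>x. - 1 * x)"
    by (rule G.prob_space_distr) simp
  show ?thesis
    unfolding neg unfolding gumbel_def logistic_def
    by (subst convolution_density)
       (use G.finite_measure_axioms G'.finite_measure_axioms neg in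
         \<open>simp_all add: int gumbel_def\<close>)
qed

lemma real_distribution_logistic: "real_distribution logistic"
proof -
  interpret G: real_distribution gumbel by (rule real_distribution_gumbel)
  show ?thesis
    unfolding gumbel_symmetrization[symmetric]
    by (intro real_distribution_convolution G.real_distribution_distr G.real_distribution_axioms) simp
qed

text \<open>Euler's reflection formula at the point \<open>\<i> * s\<close>.\<close>

lemma char_logistic:
  assumes "s \<noteq> 0"
  shows "char logistic s = complex_of_real (pi * s / sinh (pi * s))"
proof -
  interpret G: real_distribution gumbel by (rule real_distribution_gumbel)
  define z where "z = \<i> * complex_of_real s"
  have z: "z \<notin> \<int>\<^sub>\<le>\<^sub>0"
    using assms by (auto simp: z_def elim!: nonpos_Ints_cases simp: complex_eq_iff)
  have sets: "sets gumbel = sets borel" by (simp add: gumbel_def)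
  have "real_distribution (distr gumbel borel (\<lambda>x. - 1 * x))"
    by (intro G.real_distribution_distr) simp
  then have "char logistic s = char gumbel s * char gumbel (- 1 * s)"
    unfolding gumbel_symmetrization[symmetric]
    by (subst char_convolution) (use char_distr_scale[OF sets] G.real_distribution_axioms in simp_all)
  also have "\<dots> = z * (Gamma z * Gamma (1 - z))"
    using Gamma_plus1[OF z] by (simp add: char_gumbel z_def add.commute)
  also have "\<dots> = z * (pi / sin (pi * z))"
    by (simp add: Gamma_reflection_complex)
  also have "sin (pi * z) = \<i> * sinh (pi * s)"
    by (simp add: z_def complex_eq_iff Re_sin Im_sin sinh_def)
  also have "z * (pi / (\<i> * sinh (pi * s))) = complex_of_real (pi * s / sinh (pi * s))"
    by (simp add: z_def)
  finally show ?thesis .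
qed

text \<open>The same density in the form in which it occurs in the cosine integral.\<close>

lemma logistic_density_cosh: "exp x / (1 + exp x)\<^sup>2 = 1 / (4 * (cosh (x / 2))\<^sup>2)" for x :: real
proof -
  have "(2 * cosh (x / 2))\<^sup>2 * exp x = (1 + exp x)\<^sup>2"
  proof -
    have "2 * cosh (x / 2) * exp (x / 2) = 1 + exp x"
      by (simp add: cosh_def ring_distribs flip: exp_add)
    then have "(2 * cosh (x / 2) * exp (x / 2))\<^sup>2 = (1 + exp x)\<^sup>2"
      by simp
    then show ?thesis
      by (simp only: power_mult_distrib flip: exp_double) simp
  qed
  then have "exp x / (1 + exp x)\<^sup>2 = exp x / ((2 * cosh (x / 2))\<^sup>2 * exp x)"
    by simp
  also have "\<dots> = 1 / (4 * (cosh (x / 2))\<^sup>2)"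
    by (simp add: power_mult_distrib)
  finally show ?thesis .
qed

text \<open>The substitution of \<open>2 / pi * x\<close> for \<open>x\<close> turns the kernel into the logistic density, and
  the integral into the real part of the logistic characteristic function, less its value \<open>1\<close>
  at the origin.\<close>

lemma cos_minus_one_integral:
  assumes "t \<noteq> 0"
  shows "(LINT x:UNIV - {0}|lborel. (cos (t * x) - 1) * (pi / 8) * (1 / (cosh (pi * x / 4))\<^sup>2))
    = 2 * t / sinh (2 * t) - 1"
proof -
  interpret L: real_distribution logistic by (rule real_distribution_logistic)
  define s where "s = 2 * t / pi"
  have [measurable]: "(\<lambda>x::real. cosh (pi * x / 4)) \<in> borel_measurable borel"
    by (intro borel_measurable_continuous_onI continuous_intros) simp
  have [measurable_cong]: "sets logistic = sets borel" by (simp add: logistic_def)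
  have int: "complex_integrable logistic (\<lambda>x. iexp (s * x))"
    by (intro L.integrable_iexp) auto
  have "(LINT x:UNIV - {0}|lborel. (cos (t * x) - 1) * (pi / 8) * (1 / (cosh (pi * x / 4))\<^sup>2))
     = (LINT x|lborel. (cos (t * x) - 1) * (pi / 8) * (1 / (cosh (pi * x / 4))\<^sup>2))"
    unfolding set_lebesgue_integral_def
  proof (rule integral_cong_AE)
    show "AE x in lborel. indicator (UNIV - {0}) x *\<^sub>R ((cos (t * x) - 1) * (pi / 8) * (1 / (cosh (pi * x / 4))\<^sup>2))
        = (cos (t * x) - 1) * (pi / 8) * (1 / (cosh (pi * x / 4))\<^sup>2)"
      using AE_lborel_singleton[of 0] by eventually_elim simp
  qed (measurable, measurable)
  also have "\<dots> = \<bar>2 / pi\<bar> *\<^sub>R (LINT x|lborel. (cos (t * (0 + 2 / pi * x)) - 1) * (pi / 8) *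
      (1 / (cosh (pi * (0 + 2 / pi * x) / 4))\<^sup>2))"
    by (rule lborel_integral_real_affine) simp
  also have "\<dots> = (LINT x|lborel. \<bar>2 / pi\<bar> *\<^sub>R ((cos (t * (0 + 2 / pi * x)) - 1) * (pi / 8) *
      (1 / (cosh (pi * (0 + 2 / pi * x) / 4))\<^sup>2)))"
    by (rule integral_scaleR_right[symmetric])
  also have "\<dots> = (LINT x|lborel. exp x / (1 + exp x)\<^sup>2 * (cos (s * x) - 1))"
    unfolding logistic_density_cosh
    by (intro Bochner_Integration.integral_cong) (simp_all add: s_def field_simps)
  also have "\<dots> = (LINT x|logistic. cos (s * x) - 1)"
    unfolding logistic_def by (subst integral_density) auto
  also have "\<dots> = (LINT x|logistic. Re (iexp (s * x)) - 1)"
    by (simp add: Re_exp)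
  also have "\<dots> = Re (char logistic s) - 1"
    using int unfolding char_def
    by (subst Bochner_Integration.integral_diff) (auto simp: L.prob_space simp del: L.space_eq_univ)
  also have "\<dots> = 2 * t / sinh (2 * t) - 1"
    using assms by (subst char_logistic) (auto simp: s_def)
  finally show ?thesis .
qed

section \<open>Compound Poisson laws\<close>

text \<open>Conditionally on \<open>n\<close> jumps the characteristic function is the \<open>n\<close>-th power of that of the
  jump law; averaging over the Poisson number of jumps gives the exponential series.\<close>

lemma char_compound_poisson_law:
  assumes "real_distribution \<nu>" "r > 0"
  shows "char (compound_poisson_law r \<nu>) t = exp (r * (char \<nu> t - 1))"
proof -
  interpret \<nu>: real_distribution \<nu> by fact
  let ?\<Pi> = "\<Pi>\<^sub>M i\<in>(UNIV :: nat set). \<nu>"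
  let ?N = "measure_pmf (poisson_pmf r)"
  interpret Y: prob_space ?\<Pi>
    by (intro prob_space_PiM \<nu>.prob_space_axioms)
  interpret N: prob_space ?N by (rule prob_space_measure_pmf)
  interpret P: pair_prob_space ?N ?\<Pi> ..
  have [measurable_cong]: "sets \<nu> = sets borel" by (simp add: \<nu>.events_eq_borel)
  have sum_meas: "(\<lambda>(n, y). \<Sum>i<n. y i) \<in> borel_measurable (?N \<Otimes>\<^sub>M ?\<Pi>)"
  proof -
    have "(\<lambda>(n, y). \<Sum>i<n. y i) \<in>
        borel_measurable (count_space UNIV \<Otimes>\<^sub>M ?\<Pi>)"
      by (rule measurable_pair_measure_countable1) auto
    then show ?thesis
      by (simp cong: measurable_cong_sets sets_pair_measure_cong)
  qed
  have law: "distr ?\<Pi> borel (\<lambda>y. y i) = \<nu>" for i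
  proof -
    have "distr ?\<Pi> borel (\<lambda>y. y i) = distr ?\<Pi> \<nu> (\<lambda>y. y i)"
      by (intro distr_cong) (simp_all add: \<nu>.events_eq_borel)
    then show ?thesis
      using distr_PiM_component[of UNIV "\<lambda>_. \<nu>" i] \<nu>.prob_space_axioms by simp
  qed
  have "Y.indep_vars (\<lambda>_. borel) (\<lambda>i y. y i) UNIV"
  proof (subst Y.indep_vars_iff_distr_eq_PiM)
    have "distr ?\<Pi> (\<Pi>\<^sub>M i\<in>UNIV. borel) (\<lambda>x. x) = distr ?\<Pi> ?\<Pi> (\<lambda>x. x)"
      by (intro distr_cong sets_PiM_cong) (simp_all add: \<nu>.events_eq_borel)
    then show "distr ?\<Pi> (\<Pi>\<^sub>M i\<in>UNIV. borel) (\<lambda>x. \<lambda>i\<in>UNIV. x i)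
        = (\<Pi>\<^sub>M i\<in>UNIV. distr ?\<Pi> borel (\<lambda>y. y i))"
      by (simp add: law restrict_def)
  qed auto
  then have indep: "Y.indep_vars (\<lambda>_. borel) (\<lambda>i y. y i) {..<n}" for n
    by (rule Y.indep_vars_subset) simp
  have partial: "(CLINT y|?\<Pi>. iexp (t * (\<Sum>i<n. y i))) = char \<nu> t ^ n" for n
  proof -
    have "(CLINT y|?\<Pi>. iexp (t * (\<Sum>i<n. y i))) = char (distr ?\<Pi> borel (\<lambda>y. \<Sum>i<n. y i)) t"
      unfolding char_def by (subst integral_distr) auto
    also have "\<dots> = char \<nu> t ^ n"
      by (subst Y.char_distr_sum[OF indep]) (simp add: law)
    finally show ?thesis .
  qed
  have "char (compound_poisson_law r \<nu>) t
      = (CLINT p|?N \<Otimes>\<^sub>M ?\<Pi>. iexp (t * (case p of (n, y) \<Rightarrow> \<Sum>i<n. y i)))"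
    unfolding char_def compound_poisson_law_def
    using sum_meas by (subst integral_distr) auto
  also have "\<dots> = (CLINT n|?N. char \<nu> t ^ n)"
    using sum_meas by (subst P.integral_fst'[symmetric]) (auto intro!: P.integrable_iexp simp: partial simp del: of_real_mult of_real_sum)
  also have "\<dots> = (CLINT n|count_space UNIV. pmf (poisson_pmf r) n *\<^sub>R char \<nu> t ^ n)"
    unfolding measure_pmf_eq_density by (subst integral_density) auto
  also have "\<dots> = exp (r * (char \<nu> t - 1))"
  proof -
    let ?a = "\<lambda>n. pmf (poisson_pmf r) n *\<^sub>R char \<nu> t ^ n"
    let ?e = "\<lambda>n. (r * char \<nu> t) ^ n /\<^sub>R fact n"
    have a: "?a n = exp (- r) *\<^sub>R ?e n" for n
      using assms(2) by (auto simp: scaleR_conv_of_real power_mult_distrib field_simps)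
    have "summable (\<lambda>n. norm (?a n))"
      unfolding a norm_scaleR[of "exp (- r)"] by (intro summable_mult summable_norm_exp)
    then have "?a sums (CLINT n|count_space UNIV. ?a n)"
      by (intro sums_integral_count_space_nat) (simp add: integrable_count_space_nat_iff)
    moreover have "?a sums (exp (- r) *\<^sub>R exp (r * char \<nu> t))"
      unfolding a by (intro sums_scaleR_right exp_converges)
    ultimately have "(CLINT n|count_space UNIV. ?a n) = exp (- r) *\<^sub>R exp (r * char \<nu> t)"
      by (rule sums_unique2)
    then show ?thesis
      by (simp add: scaleR_conv_of_real ring_distribs exp_diff exp_minus field_simps flip: exp_of_real)
  qed
  finally show ?thesis .
qed

text \<open>The rate is \<open>1\<close>, and the jumps follow the logistic law scaled by \<open>2 / pi\<close>, which is the law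
  with density \<open>(pi / 8) / (cosh (pi * x / 4))\<^sup>2\<close>.\<close>

lemma compound_poisson_2t_sinh:
  "\<exists>\<nu>. compound_poisson \<nu> \<and>
     (\<forall>t. char \<nu> t = complex_of_real (if t = 0 then 1 else exp (2 * t / sinh (2 * t) - 1)))"
proof -
  interpret L: real_distribution logistic by (rule real_distribution_logistic)
  define \<nu> where "\<nu> = distr logistic borel (\<lambda>x. 2 / pi * x)"
  have sets: "sets logistic = sets borel" by (simp add: logistic_def)
  have \<nu>: "real_distribution \<nu>"
    unfolding \<nu>_def by (intro L.real_distribution_distr) (simp add: sets cong: measurable_cong_sets)
  have "absolutely_continuous lborel logistic"
    unfolding logistic_def by (rule absolutely_continuousI_density) simp
  moreover have "{0} \<in> null_sets lborel"
    by (simp add: null_sets_def)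
  ultimately have "{0} \<in> null_sets logistic"
    unfolding absolutely_continuous_def by blast
  then have "measure logistic {0} = 0"
    by (rule measure_eq_0_null_sets)
  moreover have "(*) (2 / pi) -` {0} = {0 :: real}"
    by auto
  ultimately have "measure \<nu> {0} = 0"
    unfolding \<nu>_def by (subst measure_distr) (simp_all add: sets cong: measurable_cong_sets)
  then have "compound_poisson (compound_poisson_law 1 \<nu>)"
    unfolding compound_poisson_def using \<nu> by (intro exI[of _ "1 :: real"] exI[of _ \<nu>]) auto
  moreover have "char (compound_poisson_law 1 \<nu>) t
      = complex_of_real (if t = 0 then 1 else exp (2 * t / sinh (2 * t) - 1))" for t
  proof (cases "t = 0")
    case True
    then show ?thesis
      by (simp add: real_distribution.char_zero real_distribution_compound_poisson_law \<nu>)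
  next
    case False
    have "char \<nu> t = char logistic (2 / pi * t)"
      unfolding \<nu>_def by (rule char_distr_scale[OF sets])
    also have "\<dots> = complex_of_real (2 * t / sinh (2 * t))"
      using False by (subst char_logistic) auto
    finally show ?thesis
      using False by (simp add: char_compound_poisson_law[OF \<nu>] flip: exp_of_real)
  qed
  ultimately show ?thesis by blast
qed

section \<open>Distinguished logarithms of positive functions\<close>

text \<open>Two logarithms of the same function differ by integer multiples of \<open>2 * pi * \<i>\<close>, and a
  continuous function with values in a discrete set is constant on the connected line.\<close>

lemma continuous_logarithm_unique:
  assumes "continuous_on UNIV g" "continuous_on UNIV h" "g 0 = h 0"
    and eq: "\<And>t::real. exp (g t) = exp (h t :: complex)"
  shows "g = h"
proof -
  let ?d = "\<lambda>t. g t - h t"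
  have period: "\<exists>n::int. ?d t = of_int (2 * n) * (pi * \<i>)" for t
    using eq[of t] unfolding exp_eq by (auto simp: algebra_simps)
  have "?d constant_on UNIV"
  proof (rule continuous_discrete_range_constant)
    show "continuous_on UNIV ?d"
      using assms by (intro continuous_intros)
    fix x :: real
    have "2 * pi \<le> norm (?d y - ?d x)" if "?d y \<noteq> ?d x" for y
    proof -
      obtain m n :: int where mn: "?d y = of_int (2 * m) * (pi * \<i>)" "?d x = of_int (2 * n) * (pi * \<i>)"
        using period by metis
      then have "?d y - ?d x = of_int (2 * (m - n)) * (pi * \<i>)" and "m \<noteq> n"
        using that by (auto simp: algebra_simps)
      then have "norm (?d y - ?d x) = 2 * \<bar>of_int (m - n)\<bar> * pi"
        by (simp only: norm_mult norm_of_int of_int_mult abs_mult) simp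
      moreover have "1 \<le> \<bar>real_of_int (m - n)\<bar>"
        using \<open>m \<noteq> n\<close> by linarith
      ultimately show ?thesis
        by simp
    qed
    then show "\<exists>e>0. \<forall>y. y \<in> UNIV \<and> ?d y \<noteq> ?d x \<longrightarrow> e \<le> norm (?d y - ?d x)"
      by (intro exI[of _ "2 * pi"]) auto
  qed simp
  then obtain c where c: "\<And>t. ?d t = c"
    by (auto simp: constant_on_def)
  have "c = 0"
    using c[of 0] assms(3) by simp
  then show ?thesis
    using c by (auto simp: fun_eq_iff)
qed

lemma distinguished_log_pos:
  fixes f :: "real \<Rightarrow> real"
  assumes cont: "continuous_on UNIV f" and pos: "\<And>t. 0 < f t" and "f 0 = 1"
  shows "distinguished_log (\<lambda>t. complex_of_real (f t)) = (\<lambda>t. complex_of_real (ln (f t)))"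
  unfolding distinguished_log_def
proof (rule the_equality)
  let ?l = "\<lambda>t. complex_of_real (ln (f t))"
  have l: "continuous_on UNIV ?l" "?l 0 = 0" "\<And>t. exp (?l t) = f t"
    using pos assms(3) by (auto intro!: continuous_intros cont simp: exp_of_real less_imp_neq[OF pos, symmetric])
  then show "continuous_on UNIV ?l \<and> ?l 0 = 0 \<and> (\<forall>t. exp (?l t) = f t)"
    by simp
  show "g = ?l" if "continuous_on UNIV g \<and> g 0 = 0 \<and> (\<forall>t. exp (g t) = f t)" for g :: "real \<Rightarrow> complex"
    using that l by (intro continuous_logarithm_unique) auto
qed

lemma bdlp_char_pos:
  fixes f :: "real \<Rightarrow> real"
  assumes "continuous_on UNIV f" "\<And>t. 0 < f t" "f 0 = 1"
    and "t \<noteq> 0" and deriv: "(f has_real_derivative f') (at t)"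
  shows "bdlp_char (\<lambda>t. complex_of_real (f t)) t = complex_of_real (exp (t * f' / f t))"
proof -
  have "((\<lambda>t. ln (f t)) has_real_derivative f' / f t) (at t)"
    using assms(2)[of t] deriv by (auto intro!: derivative_eq_intros simp: field_simps)
  then have "((\<lambda>t. complex_of_real (ln (f t))) has_vector_derivative of_real (f' / f t)) (at t)"
    by (intro has_vector_derivative_of_real) (simp add: has_real_derivative_iff_has_vector_derivative)
  then show ?thesis
    using assms(4)
    by (simp add: bdlp_char_def distinguished_log_pos[OF assms(1-3)] vector_derivative_at
        flip: exp_of_real)
qed

section \<open>The function tanh t / t\<close>

definition tanhc :: "real \<Rightarrow> real" where
  "tanhc t = (if t = 0 then 1 else tanh t / t)"

lemma tanhc_pos: "0 < tanhc t"
  by (cases t "0 :: real" rule: linorder_cases) (auto simp: tanhc_def divide_neg_neg zero_less_divide_iff)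

text \<open>The derivative is displayed as the function times its logarithmic derivative, since it is
  \<open>t\<close> times the latter that enters the driving characteristic function.\<close>

lemma tanhc_has_derivative:
  assumes "t \<noteq> 0"
  shows "(tanhc has_real_derivative tanhc t * (2 * t / sinh (2 * t) - 1) / t) (at t)"
proof -
  have "((\<lambda>t. tanh t / t) has_real_derivative tanhc t * (2 * t / sinh (2 * t) - 1) / t) (at t)"
  proof -
    have "sinh t \<noteq> 0" "cosh t \<noteq> 0"
      using assms by auto
    moreover from this have "1 - (tanh t)\<^sup>2 = 1 / (cosh t)\<^sup>2"
      by (simp add: tanh_def power_divide diff_divide_eq_iff) (simp add: cosh_square_eq)
    ultimately have "((1 - (tanh t)\<^sup>2) * t - tanh t) / (t * t) = tanhc t * (2 * t / sinh (2 * t) - 1) / t"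
      using assms by (simp add: tanhc_def tanh_def sinh_double divide_simps power2_eq_square)
    moreover have "((\<lambda>t. tanh t / t) has_real_derivative ((1 - (tanh t)\<^sup>2) * t - tanh t) / (t * t)) (at t)"
      using assms by (auto intro!: derivative_eq_intros)
    ultimately show ?thesis
      by simp
  qed
  then show ?thesis
    by (rule has_field_derivative_transform_within_open[where S = "- {0}"]) (use assms in \<open>auto simp: tanhc_def\<close>)
qed

section \<open>Characteristic functions tending to one\<close>

text \<open>This is the estimate \<open>(norm (z + w))\<^sup>2 \<le> 2 * (norm z)\<^sup>2 + 2 * (norm w)\<^sup>2\<close> for the chords
  \<open>z = exp (\<i> * b) - 1\<close> and \<open>w = 1 - exp (\<i> * a)\<close>, whose sum is a chord over the angle
  \<open>b - a\<close>.\<close>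

lemma one_minus_cos_increment_le:
  "1 - cos (b - a) \<le> 2 * (1 - cos b) + 2 * (1 - cos a)" for a b :: real
proof -
  \<comment> \<open>By the parallelogram law the two sides differ by half of \<open>(norm (z - w))\<^sup>2\<close>.\<close>
  have "2 * (1 - cos b) + 2 * (1 - cos a) - (1 - cos (b - a))
     = ((cos a + cos b - 2)\<^sup>2 + (sin a + sin b)\<^sup>2) / 2"
  proof -
    have *: "(sin a)\<^sup>2 = 1 - (cos a)\<^sup>2" "(sin b)\<^sup>2 = 1 - (cos b)\<^sup>2"
      by (simp_all add: sin_squared_eq)
    show ?thesis
      unfolding cos_diff power2_sum power2_diff * by (simp add: field_simps power2_eq_square)
  qed
  then show ?thesis
    by (smt (verit) sum_power2_ge_zero divide_nonneg_pos)
qed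

text \<open>Integrating the previous inequality bounds \<open>1 - Re \<phi>(h)\<close> by
  \<open>2 * (1 - Re \<phi>(s + h)) + 2 * (1 - Re \<phi>(s))\<close> for every \<open>s\<close>, and the bound vanishes as
  \<open>s\<close> tends to infinity.\<close>

lemma (in real_distribution) Re_char_eq_1_if_tendsto_1:
  assumes lim: "(char M \<longlongrightarrow> 1) at_top"
  shows "Re (char M h) = 1"
proof -
  have int: "complex_integrable M (\<lambda>x. iexp (s * x))" for s
    by (intro integrable_iexp) auto
  have cosint: "integrable M (\<lambda>x. cos (s * x))" for s
    using integrable_Re[OF int[of s]] by (simp add: Re_exp)
  have Re_char: "1 - Re (char M s) = (LINT x|M. 1 - cos (s * x))" for s
  proof -
    have "Re (char M s) = (LINT x|M. cos (s * x))"
      unfolding char_def using int[of s] by (simp add: Re_exp flip: integral_Re)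
    then show ?thesis
      using cosint by (subst Bochner_Integration.integral_diff) (auto simp: prob_space simp del: space_eq_univ)
  qed
  have int1: "integrable M (\<lambda>x. 1 - cos (s * x))" for s
    using cosint by simp
  have "1 - Re (char M h) \<le> 2 * (1 - Re (char M (s + h))) + 2 * (1 - Re (char M s))" for s
  proof -
    have "1 - Re (char M h) \<le> (LINT x|M. 2 * (1 - cos ((s + h) * x)) + 2 * (1 - cos (s * x)))"
      unfolding Re_char
    proof (intro integral_mono Bochner_Integration.integrable_add integrable_mult_right int1)
      show "1 - cos (h * x) \<le> 2 * (1 - cos ((s + h) * x)) + 2 * (1 - cos (s * x))" for x
        using one_minus_cos_increment_le[of "(s + h) * x" "s * x"] by (simp add: ring_distribs)
    qed
    also have "\<dots> = 2 * (1 - Re (char M (s + h))) + 2 * (1 - Re (char M s))"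
      unfolding Re_char by (subst Bochner_Integration.integral_add) (simp_all only: int1 integrable_mult_right integral_mult_right_zero)
    finally show ?thesis .
  qed
  moreover have "((\<lambda>s. 2 * (1 - Re (char M (s + h))) + 2 * (1 - Re (char M s))) \<longlongrightarrow>
      2 * (1 - Re 1) + 2 * (1 - Re 1)) at_top"
    by (intro tendsto_intros lim filterlim_compose[OF lim]) real_asymp
  ultimately have "1 - Re (char M h) \<le> 0"
    by (intro tendsto_lowerbound[of _ _ at_top]) auto
  moreover have "Re (char M h) \<le> 1"
    using complex_Re_le_cmod[of "char M h"] cmod_char_le_1[of h] by linarith
  ultimately show ?thesis
    by simp
qed

section \<open>Exclusion from the Urbanik class \<open>L\<^sub>1\<close>\<close>

lemma char_decomposes:
  assumes "decomposes t \<mu> \<rho>" "real_distribution \<mu>" "real_distribution \<rho>"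
  shows "char \<mu> s = char \<mu> (exp (- t) * s) * char \<rho> s"
proof -
  interpret \<mu>: real_distribution \<mu> by fact
  have "char \<mu> s = char (distr \<mu> borel (\<lambda>x. exp (- t) * x) \<star> \<rho>) s"
    using arg_cong[OF assms(1)[unfolded decomposes_def], of "\<lambda>m. char m s"] .
  then show ?thesis
    using assms(2,3)
    by (simp add: char_convolution \<mu>.real_distribution_distr char_distr_scale \<mu>.events_eq_borel)
qed

text \<open>Already the single value \<open>t = ln 2\<close> in both decompositions is contradictory.
  The second factor \<open>\<sigma>\<close> has characteristic function \<open>\<phi> s * \<phi> (s / 4) / (\<phi> (s / 2))\<^sup>2\<close>, in
  which the limit at infinity and the value at \<open>4\<close> disagree.\<close>

lemma tanhc_not_in_L1:
  assumes "\<And>t. char \<mu> t = tanhc t"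
  shows "\<mu> \<notin> urbanik_class 1"
proof
  assume "\<mu> \<in> urbanik_class 1"
  then have \<mu>: "real_distribution \<mu>" and "\<forall>t>0. \<exists>\<rho>\<in>urbanik_class 0. decomposes t \<mu> \<rho>"
    by auto
  moreover have "ln 2 > (0::real)"
    by simp
  ultimately obtain \<rho> where "\<rho> \<in> urbanik_class 0" and dec\<rho>: "decomposes (ln 2) \<mu> \<rho>"
    by blast
  then have \<rho>: "real_distribution \<rho>" and "\<exists>\<sigma>. infinitely_divisible \<sigma> \<and> decomposes (ln 2) \<rho> \<sigma>"
    using \<open>ln 2 > (0::real)\<close> by auto
  then obtain \<sigma> where \<sigma>: "real_distribution \<sigma>" and dec\<sigma>: "decomposes (ln 2) \<rho> \<sigma>"
    by (auto simp: infinitely_divisible_def)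
  have half: "exp (- ln 2) = (1 / 2 :: real)"
    by (simp add: exp_minus)
  have nz: "char \<mu> s \<noteq> 0" for s
    using tanhc_pos[of s] by (simp add: assms)
  have char\<rho>: "char \<rho> s = char \<mu> s / char \<mu> (s / 2)" for s
    using char_decomposes[OF dec\<rho> \<mu> \<rho>, of s] nz by (simp add: half field_simps)
  have char\<sigma>: "char \<sigma> s = tanhc s * tanhc (s / 4) / (tanhc (s / 2))\<^sup>2" for s
  proof -
    have "char \<sigma> s = char \<rho> s / char \<rho> (s / 2)"
      using char_decomposes[OF dec\<sigma> \<rho> \<sigma>, of s] nz by (simp add: half char\<rho> field_simps)
    then show ?thesis
      by (simp add: char\<rho> assms power2_eq_square)
  qed
  have char\<sigma>': "char \<sigma> s = tanh s * tanh (s / 4) / (tanh (s / 2))\<^sup>2" if "s \<noteq> 0" for s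
    using that by (simp add: char\<sigma> tanhc_def power2_eq_square)
  interpret \<sigma>: real_distribution \<sigma> by fact
  have "(char \<sigma> \<longlongrightarrow> 1) at_top"
  proof (rule Lim_transform_eventually)
    have "((\<lambda>s::real. tanh s * tanh (s / 4) / (tanh (s / 2))\<^sup>2) \<longlongrightarrow> 1 * 1 / 1\<^sup>2) at_top"
      by (intro tendsto_intros filterlim_compose[OF tanh_real_at_top]) (real_asymp | simp)+
    from tendsto_of_real[OF this, where 'a = complex]
    show "((\<lambda>s. complex_of_real (tanh s * tanh (s / 4) / (tanh (s / 2))\<^sup>2)) \<longlongrightarrow> 1) at_top"
      by simp
    show "\<forall>\<^sub>F s in at_top. complex_of_real (tanh s * tanh (s / 4) / (tanh (s / 2))\<^sup>2) = char \<sigma> s"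
      using eventually_gt_at_top[of 0] by eventually_elim (simp add: char\<sigma>')
  qed
  then have one: "Re (char \<sigma> 4) = 1"
    by (rule \<sigma>.Re_char_eq_1_if_tendsto_1)
  \<comment> \<open>At the point \<open>4\<close> the quotient involves \<open>tanh\<close> at \<open>1\<close>, \<open>2\<close> and \<open>4\<close>, all of which the
    duplication formula expresses through \<open>tanh 1\<close>.\<close>
  define x y :: real where "x = tanh 1" and "y = tanh 2"
  have tanh_double: "tanh (2 * u) = 2 * tanh u / (1 + (tanh u)\<^sup>2)" for u :: real
    using tanh_add[of u u] by (simp add: power2_eq_square)
  have pos: "0 < x" "0 < y"
    by (simp_all add: x_def y_def)
  have denom: "1 + x\<^sup>2 \<noteq> 0" "1 + y\<^sup>2 \<noteq> 0"
    by (smt (verit) zero_le_power2)+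
  have "y = 2 * x / (1 + x\<^sup>2)"
    using tanh_double[of 1] by (simp add: x_def y_def)
  then have "y * (1 + x\<^sup>2) = 2 * x"
    using denom by (simp add: nonzero_eq_divide_eq)
  moreover have "y * (1 + y\<^sup>2) = 2 * x"
  proof -
    have "y\<^sup>2 = tanh 4 * x"
      using one pos by (simp add: char\<sigma>' x_def y_def)
    also have "tanh 4 = 2 * y / (1 + y\<^sup>2)"
      using tanh_double[of 2] by (simp add: y_def)
    finally have "y\<^sup>2 * (1 + y\<^sup>2) = 2 * y * x"
      using denom by (simp add: nonzero_eq_divide_eq)
    then show ?thesis
      using pos by (simp add: power2_eq_square)
  qed
  ultimately have "y * (1 + x\<^sup>2) = y * (1 + y\<^sup>2)"
    by simp
  then have "x = y"
    using \<open>0 < x\<close> \<open>0 < y\<close> by (simp add: power2_eq_iff)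
  then show False
    by (simp add: x_def y_def)
qed

section \<open>The hyperbolic-tangent law\<close>

theorem corollary1:
  fixes M :: "'a measure" and T :: "'a \<Rightarrow> real"
  assumes "prob_space M"
    and "T \<in> borel_measurable M"
    and "\<And>t. char (distr M borel T) t = complex_of_real (if t = 0 then 1 else tanh t / t)"
  shows
    "(\<forall>t::real.
        (LINT x:UNIV - {0}|lborel. (cos (t * x) - 1) * (pi / 8) * (1 / (cosh (pi * x / 4))\<^sup>2))
          = (if t = 0 then 0 else 2 * t / sinh (2 * t) - 1))
     \<and> (\<forall>t::real. t \<noteq> 0 \<longrightarrow>
          bdlp_char (char (distr M borel T)) t
            = complex_of_real (exp (2 * t / sinh (2 * t) - 1)))
     \<and> (\<exists>\<nu>. compound_poisson \<nu> \<and> char \<nu> = bdlp_char (char (distr M borel T)))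
     \<and> distr M borel T \<notin> urbanik_class 1"
proof -
  interpret M: prob_space M by fact
  interpret T: real_distribution "distr M borel T"
    using assms(2) by (rule M.real_distribution_distr)
  have char_T: "char (distr M borel T) t = tanhc t" for t
    by (simp add: assms(3) tanhc_def)
  have "continuous_on UNIV (\<lambda>t. Re (char (distr M borel T) t))"
    by (intro continuous_on_Re continuous_at_imp_continuous_on ballI T.isCont_char)
  then have cont: "continuous_on UNIV tanhc"
    by (simp add: char_T)
  have bdlp: "bdlp_char (char (distr M borel T)) t = complex_of_real (exp (2 * t / sinh (2 * t) - 1))"
    if "t \<noteq> 0" for t
  proof -
    have "bdlp_char (char (distr M borel T)) t = bdlp_char (\<lambda>t. complex_of_real (tanhc t)) t"
      by (rule arg_cong[where f = "\<lambda>\<phi>. bdlp_char \<phi> t"]) (simp add: fun_eq_iff char_T)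
    also have "\<dots> = exp (t * (tanhc t * (2 * t / sinh (2 * t) - 1) / t) / tanhc t)"
      by (rule bdlp_char_pos[OF cont tanhc_pos _ that tanhc_has_derivative[OF that]]) (simp add: tanhc_def)
    finally show ?thesis
      using that tanhc_pos[of t] by simp
  qed
  obtain \<nu> where \<nu>: "compound_poisson \<nu>"
    and char_\<nu>: "\<And>t. char \<nu> t = complex_of_real (if t = 0 then 1 else exp (2 * t / sinh (2 * t) - 1))"
    using compound_poisson_2t_sinh by blast
  have "char \<nu> t = bdlp_char (char (distr M borel T)) t" for t
    using bdlp[of t] by (cases "t = 0") (simp_all add: char_\<nu>, simp add: bdlp_char_def)
  then have "char \<nu> = bdlp_char (char (distr M borel T))"
    by (simp add: fun_eq_iff)
  then show ?thesis
    using cos_minus_one_integral bdlp \<nu> tanhc_not_in_L1[OF char_T] by auto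
qed

end
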